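(* For $1\le k\le 5$ let $E_k$ denote the Diophantine equation $x^2+y^2+z^2+2yz=kxyz$, and let "solution" mean positive integer solution. The following hold for a triple $(A_1,A_2,A_3)$ of positive integers: (1) $(A_1,A_2,A_3)$ is a solution of $E_1$ in $\widehat{\Gamma}[(9,6,3)]$ (respectively $\widehat{\Gamma}[(9,3,6)]$) if and only if $3$ divides $A_i$ for $i=1,2,3$ and $(\frac{A_1}{3},\frac{A_2}{3},\frac{A_3}{3})$ is a solution of $E_3$ in $\widehat{\Gamma}[(3,2,1)]$ (respectively $\widehat{\Gamma}[(3,1,2)]$). (2) $(A_1,A_2,A_3)$ is a solution of $E_1$ in $\widehat{\Gamma}[(8,4,4)]$ if and only if $2$ divides $A_i$ for $i=1,2,3$ and $(\frac{A_1}{2},\frac{A_2}{2},\frac{A_3}{2})$ is a solution of $E_2$, if and only if $4$ divides $A_i$ for $i=1,2,3$ and $(\frac{A_1}{4},\frac{A_2}{4},\frac{A_3}{4})$ is a solution of $E_4$. (3) $(A_1,A_2,A_3)$ is a solution of $E_1$ in $\widehat{\Gamma}[(5,5,5)]$ if and only if $5$ divides $A_i$ for $i=1,2,3$ and $(\frac{A_1}{5},\frac{A_2}{5},\frac{A_3}{5})$ is a solution of $E_5$.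
   Context: $\widehat{\Gamma}=\langle\widehat{\mu}_1,\widehat{\mu}_2,\widehat{\mu}_3\rangle$ is the group of transformations of $\mathbb{Q}_+^3$ (triples of positive rationals) generated by the involutions $$\widehat{\mu}_1(x,y,z)=\left(\frac{(y+z)^2}{x},y,z\right),\quad \widehat{\mu}_2(x,y,z)=\left(x,\frac{x^2+z^2}{y},z\right),\quad \widehat{\mu}_3(x,y,z)=\left(x,y,\frac{x^2+y^2}{z}\right),$$ and $\widehat{\Gamma}[p]$ denotes the $\widehat{\Gamma}$-orbit of $p$. *)

theory Defs
  imports Complex_Main "HOL-Algebra.Group_Action" "HOL-Algebra.Generated_Groups"
begin

definition pos_rat3 :: "(rat \<times> rat \<times> rat) set" where
  "pos_rat3 = {(x, y, z). x > 0 \<and> y > 0 \<and> z > 0}"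

text \<open>
  The permutations in \<^const>\<open>BijGroup\<close> are extensional functions, so the generators are
  restricted to \<^const>\<open>pos_rat3\<close>. The lemma \<open>mu_hat_Bij\<close> below shows that they
  do lie in this group.
\<close>

definition mu_hat1 :: "rat \<times> rat \<times> rat \<Rightarrow> rat \<times> rat \<times> rat" where
  "mu_hat1 = (\<lambda>(x, y, z) \<in> pos_rat3. ((y + z)\<^sup>2 / x, y, z))"

definition mu_hat2 :: "rat \<times> rat \<times> rat \<Rightarrow> rat \<times> rat \<times> rat" where
  "mu_hat2 = (\<lambda>(x, y, z) \<in> pos_rat3. (x, (x\<^sup>2 + z\<^sup>2) / y, z))"

definition mu_hat3 :: "rat \<times> rat \<times> rat \<Rightarrow> rat \<times> rat \<times> rat" where
  "mu_hat3 = (\<lambda>(x, y, z) \<in> pos_rat3. (x, y, (x\<^sup>2 + y\<^sup>2) / z))"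

definition Gamma_hat :: "(rat \<times> rat \<times> rat \<Rightarrow> rat \<times> rat \<times> rat) monoid" where
  "Gamma_hat = (BijGroup pos_rat3)
     \<lparr>carrier := generate (BijGroup pos_rat3) {mu_hat1, mu_hat2, mu_hat3}\<rparr>"

definition Gamma_hat_orbit :: "rat \<times> rat \<times> rat \<Rightarrow> (rat \<times> rat \<times> rat) set" where
  "Gamma_hat_orbit p = orbit Gamma_hat (\<lambda>g. g) p"

definition rat_triple :: "int \<times> int \<times> int \<Rightarrow> rat \<times> rat \<times> rat" where
  "rat_triple = (\<lambda>(x, y, z). (of_int x, of_int y, of_int z))"

definition is_solution :: "int \<Rightarrow> int \<times> int \<times> int \<Rightarrow> bool" where
  "is_solution k = (\<lambda>(x, y, z). x > 0 \<and> y > 0 \<and> z > 0 \<and>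
     x\<^sup>2 + y\<^sup>2 + z\<^sup>2 + 2 * y * z = k * x * y * z)"

lemma bij_if_involution:
  assumes "\<And>p. p \<in> S \<Longrightarrow> f p \<in> S" and "\<And>p. p \<in> S \<Longrightarrow> f (f p) = p"
  shows "bij_betw f S S"
  by (rule bij_betw_byWitness[where f' = f]) (use assms in auto)

lemma mu_hat_pos_rat3:
  assumes "p \<in> pos_rat3"
  shows "mu_hat1 p \<in> pos_rat3" "mu_hat2 p \<in> pos_rat3" "mu_hat3 p \<in> pos_rat3"
  using assms
  by (auto simp: mu_hat1_def mu_hat2_def mu_hat3_def pos_rat3_def power2_eq_square add_pos_pos)

lemma mu_hat_involution:
  assumes "p \<in> pos_rat3"
  shows "mu_hat1 (mu_hat1 p) = p" "mu_hat2 (mu_hat2 p) = p" "mu_hat3 (mu_hat3 p) = p"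
proof -
  obtain x y z where p: "p = (x, y, z)" "x > 0" "y > 0" "z > 0"
    using assms by (auto simp: pos_rat3_def)
  then have nz: "x \<noteq> 0" "y \<noteq> 0" "z \<noteq> 0" "y + z > 0" "x\<^sup>2 + z\<^sup>2 > 0" "x\<^sup>2 + y\<^sup>2 > 0"
    by (auto simp: add_pos_pos)
  show "mu_hat1 (mu_hat1 p) = p" "mu_hat2 (mu_hat2 p) = p" "mu_hat3 (mu_hat3 p) = p"
    using p nz mu_hat_pos_rat3[OF assms]
    by (auto simp: mu_hat1_def mu_hat2_def mu_hat3_def pos_rat3_def)
qed

lemma mu_hat_Bij: "{mu_hat1, mu_hat2, mu_hat3} \<subseteq> carrier (BijGroup pos_rat3)"
proof -
  have "bij_betw mu_hat1 pos_rat3 pos_rat3" "bij_betw mu_hat2 pos_rat3 pos_rat3"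
    "bij_betw mu_hat3 pos_rat3 pos_rat3"
    by (auto intro!: bij_if_involution simp: mu_hat_pos_rat3 mu_hat_involution)
  then show ?thesis
    by (auto simp: BijGroup_def Bij_def mu_hat1_def mu_hat2_def mu_hat3_def)
qed

end

theory Submission
  imports Defs
begin

text \<open>
  The generators are homogeneous of degree one and are the Vieta involutions of each \<open>E\<^sub>k\<close>, so orbits
  scale and consist of integral solutions as soon as they contain one; multiplication by \<open>d\<close>
  turns a solution of \<open>E\<^bsub>kd\<^esub>\<close> into one of \<open>E\<^sub>k\<close>. For \<open>k = 2\<close> and \<open>k = 5\<close>, descent on
  \<open>x + y + z\<close> connects every solution to one that no generator decreases, and the only such
  solutions are \<open>(4, 2, 2)\<close> and \<open>(1, 1, 1)\<close> respectively. A solution of \<open>E\<^sub>4\<close> doubles to one of \<open>E\<^sub>2\<close>.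
\<close>

section \<open>Orbits of the group: closure under the generators and induction\<close>

lemma Gamma_hat_orbit_eq:
  "Gamma_hat_orbit p = {g p | g. g \<in> generate (BijGroup pos_rat3) {mu_hat1, mu_hat2, mu_hat3}}"
  by (auto simp: Gamma_hat_orbit_def orbit_def Gamma_hat_def)

lemma generate_pos_rat3:
  assumes "g \<in> generate (BijGroup pos_rat3) {mu_hat1, mu_hat2, mu_hat3}"
  shows "g \<in> Bij pos_rat3"
  using group.generate_in_carrier[OF group_BijGroup mu_hat_Bij assms]
  by (simp add: BijGroup_def)

lemma BijGroup_mult_apply:
  assumes "g \<in> Bij S" "h \<in> Bij S" "p \<in> S"
  shows "(g \<otimes>\<^bsub>BijGroup S\<^esub> h) p = g (h p)"
  using assms by (simp add: BijGroup_def compose_def)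

text \<open>\<open>generate\<close> admits inverses of generators as a separate case. Since the
  generators are involutions, that case brings in no new maps, and orbit induction needs only three
  step cases.\<close>

lemma mu_hat_inv:
  assumes "h \<in> {mu_hat1, mu_hat2, mu_hat3}"
  shows "inv\<^bsub>BijGroup pos_rat3\<^esub> h = h"
proof (rule group.inv_equality[OF group_BijGroup])
  show h: "h \<in> carrier (BijGroup pos_rat3)"
    using assms mu_hat_Bij by blast
  then have "h \<in> Bij pos_rat3"
    by (simp add: BijGroup_def)
  moreover have "compose pos_rat3 h h = (\<lambda>p\<in>pos_rat3. p)"
  proof -
    have "h (h p) = p" if "p \<in> pos_rat3" for p
      using assms mu_hat_involution[OF that] by blast
    then show ?thesis by (auto simp: compose_def restrict_def)
  qed
  ultimately show "h \<otimes>\<^bsub>BijGroup pos_rat3\<^esub> h = \<one>\<^bsub>BijGroup pos_rat3\<^esub>"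
    by (simp add: BijGroup_def)
qed (use assms mu_hat_Bij in blast)

lemma Gamma_hat_orbit_refl:
  assumes "p \<in> pos_rat3"
  shows "p \<in> Gamma_hat_orbit p"
proof -
  have "\<one>\<^bsub>BijGroup pos_rat3\<^esub> p = p"
    using assms by (simp add: BijGroup_def)
  then show ?thesis
    unfolding Gamma_hat_orbit_eq using generate.one by (metis (mono_tags, lifting) mem_Collect_eq)
qed

lemma Gamma_hat_orbit_step:
  assumes "p \<in> pos_rat3" "q \<in> Gamma_hat_orbit p"
  shows "mu_hat1 q \<in> Gamma_hat_orbit p" "mu_hat2 q \<in> Gamma_hat_orbit p"
    "mu_hat3 q \<in> Gamma_hat_orbit p"
proof -
  obtain g where g: "g \<in> generate (BijGroup pos_rat3) {mu_hat1, mu_hat2, mu_hat3}" "q = g p"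
    using assms(2) by (auto simp: Gamma_hat_orbit_eq)
  have "h q \<in> Gamma_hat_orbit p" if h: "h \<in> {mu_hat1, mu_hat2, mu_hat3}" for h
  proof -
    have hg: "h \<in> generate (BijGroup pos_rat3) {mu_hat1, mu_hat2, mu_hat3}"
      using h by (rule generate.incl)
    have "(h \<otimes>\<^bsub>BijGroup pos_rat3\<^esub> g) p = h q"
      using BijGroup_mult_apply[OF hg[THEN generate_pos_rat3] g(1)[THEN generate_pos_rat3] assms(1)] g(2)
      by simp
    with generate.eng[OF hg g(1)] show ?thesis
      unfolding Gamma_hat_orbit_eq by (metis (mono_tags, lifting) mem_Collect_eq)
  qed
  then show "mu_hat1 q \<in> Gamma_hat_orbit p" "mu_hat2 q \<in> Gamma_hat_orbit p"
    "mu_hat3 q \<in> Gamma_hat_orbit p"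
    by auto
qed

lemma Gamma_hat_orbit_induct [consumes 2, case_names base mu1 mu2 mu3]:
  assumes "q \<in> Gamma_hat_orbit p" "p \<in> pos_rat3" "P p"
    and step: "\<And>r. r \<in> pos_rat3 \<Longrightarrow> P r \<Longrightarrow> P (mu_hat1 r)"
      "\<And>r. r \<in> pos_rat3 \<Longrightarrow> P r \<Longrightarrow> P (mu_hat2 r)"
      "\<And>r. r \<in> pos_rat3 \<Longrightarrow> P r \<Longrightarrow> P (mu_hat3 r)"
  shows "P q"
proof -
  obtain g where g: "g \<in> generate (BijGroup pos_rat3) {mu_hat1, mu_hat2, mu_hat3}" "q = g p"
    using assms(1) by (auto simp: Gamma_hat_orbit_eq)
  \<comment> \<open>Induction over \<open>generate\<close> splits a product into two arbitrary group
    elements, so preservation of \<open>P\<close> is claimed for every starting point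
    \<open>r\<close> and not just for \<open>p\<close>.\<close>
  have "\<forall>r\<in>pos_rat3. P r \<longrightarrow> P (g r)"
    using g(1)
  proof (induction rule: generate.induct)
    case one
    then show ?case by (simp add: BijGroup_def)
  next
    case (incl h)
    then show ?case using step by auto
  next
    case (inv h)
    then show ?case using step by (auto simp: mu_hat_inv)
  next
    case (eng g h)
    have B: "g \<in> Bij pos_rat3" "h \<in> Bij pos_rat3"
      using eng.hyps by (simp_all add: generate_pos_rat3)
    then have "h r \<in> pos_rat3" if "r \<in> pos_rat3" for r
      using that by (auto simp: Bij_def bij_betw_def)
    with eng.IH show ?case
      by (simp add: BijGroup_mult_apply[OF B])
  qed
  with assms(2,3) g(2) show ?thesis by blast
qed

section \<open>Scaling of orbits by positive rationals\<close>

definition scale3 :: "rat \<Rightarrow> rat \<times> rat \<times> rat \<Rightarrow> rat \<times> rat \<times> rat" where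
  "scale3 c = (\<lambda>(x, y, z). (c * x, c * y, c * z))"

lemma scale3_pos_rat3:
  assumes "c > 0" "p \<in> pos_rat3"
  shows "scale3 c p \<in> pos_rat3"
  using assms by (auto simp: scale3_def pos_rat3_def)

lemma mu_hat_scale3:
  assumes "c > 0" "p \<in> pos_rat3"
  shows "mu_hat1 (scale3 c p) = scale3 c (mu_hat1 p)"
    "mu_hat2 (scale3 c p) = scale3 c (mu_hat2 p)"
    "mu_hat3 (scale3 c p) = scale3 c (mu_hat3 p)"
  using assms scale3_pos_rat3[OF assms]
  by (auto simp: scale3_def mu_hat1_def mu_hat2_def mu_hat3_def pos_rat3_def
      field_simps power2_eq_square)

lemma Gamma_hat_orbit_scale3:
  assumes "c > 0" "p \<in> pos_rat3" "q \<in> Gamma_hat_orbit p"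
  shows "scale3 c q \<in> Gamma_hat_orbit (scale3 c p)"
  using assms(3,2)
proof (induction rule: Gamma_hat_orbit_induct)
  case base
  then show ?case by (intro Gamma_hat_orbit_refl scale3_pos_rat3 assms)
next
  case (mu1 r)
  then show ?case
    using Gamma_hat_orbit_step(1)[OF scale3_pos_rat3[OF assms(1,2)]] mu_hat_scale3(1)[OF assms(1)]
    by metis
next
  case (mu2 r)
  then show ?case
    using Gamma_hat_orbit_step(2)[OF scale3_pos_rat3[OF assms(1,2)]] mu_hat_scale3(2)[OF assms(1)]
    by metis
next
  case (mu3 r)
  then show ?case
    using Gamma_hat_orbit_step(3)[OF scale3_pos_rat3[OF assms(1,2)]] mu_hat_scale3(3)[OF assms(1)]
    by metis
qed

lemma Gamma_hat_orbit_scale3_iff: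
  assumes "c > 0" "p \<in> pos_rat3"
  shows "scale3 c q \<in> Gamma_hat_orbit (scale3 c p) \<longleftrightarrow> q \<in> Gamma_hat_orbit p"
proof
  assume "scale3 c q \<in> Gamma_hat_orbit (scale3 c p)"
  then have "scale3 (1 / c) (scale3 c q) \<in> Gamma_hat_orbit (scale3 (1 / c) (scale3 c p))"
    using assms by (intro Gamma_hat_orbit_scale3[where c = "1 / c"] scale3_pos_rat3) auto
  moreover have "scale3 (1 / c) (scale3 c r) = r" for r
    using assms(1) by (cases r) (simp add: scale3_def)
  ultimately show "q \<in> Gamma_hat_orbit p" by metis
qed (rule Gamma_hat_orbit_scale3[OF assms])

section \<open>Vieta involutions on integral solutions\<close>

lemma is_solution_pos_rat3: "is_solution k t \<Longrightarrow> rat_triple t \<in> pos_rat3"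
  by (auto simp: is_solution_def rat_triple_def pos_rat3_def)

text \<open>Each equation is a monic quadratic in each coordinate. With \<open>s\<close> the sum and
  \<open>c\<close> the product of its roots, the second root is both the integer
  \<open>s - x\<close> and the quotient \<open>c / x\<close> that occurs in the generators.\<close>

lemma vieta_sum:
  fixes x :: int
  assumes "x > 0" "x * (s - x) = c" "c > 0"
  shows "s - x > 0" "(of_int c :: rat) / of_int x = of_int (s - x)"
proof -
  show "s - x > 0"
    using assms by (metis zero_less_mult_pos)
  show "(of_int c :: rat) / of_int x = of_int (s - x)"
    using assms(1) unfolding assms(2)[symmetric] by simp
qed

text \<open>As a quadratic in \<open>x\<close> the equation is x^2 - k y z x + (y + z)^2 = 0, and
  \<open>mu_hat1\<close> exchanges its two roots.\<close>

lemma vieta_mu_hat1: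
  assumes "is_solution k (x, y, z)"
  shows "is_solution k (k * y * z - x, y, z)"
    "mu_hat1 (rat_triple (x, y, z)) = rat_triple (k * y * z - x, y, z)"
    "x * (k * y * z - x) = (y + z)\<^sup>2"
proof -
  have pos: "x > 0" "y > 0" "z > 0" and eq: "x\<^sup>2 + y\<^sup>2 + z\<^sup>2 + 2 * y * z = k * x * y * z"
    using assms by (auto simp: is_solution_def)
  show prod: "x * (k * y * z - x) = (y + z)\<^sup>2"
    using eq by (simp add: algebra_simps power2_eq_square)
  note v = vieta_sum[OF pos(1) prod]
  have c: "(y + z)\<^sup>2 > 0"
    using pos by (auto simp: power2_eq_square)
  have "(k * y * z - x)\<^sup>2 + y\<^sup>2 + z\<^sup>2 + 2 * y * z = k * (k * y * z - x) * y * z"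
    using eq by (simp add: algebra_simps power2_eq_square)
  then show "is_solution k (k * y * z - x, y, z)"
    using v(1)[OF c] pos by (simp add: is_solution_def)
  show "mu_hat1 (rat_triple (x, y, z)) = rat_triple (k * y * z - x, y, z)"
    using v(2)[OF c] pos by (simp add: mu_hat1_def rat_triple_def pos_rat3_def)
qed

text \<open>As a quadratic in \<open>y\<close> the equation is y^2 - (k x z - 2 z) y + (x^2 + z^2) =
  0, and \<open>mu_hat2\<close> exchanges its two roots.\<close>

lemma vieta_mu_hat2:
  assumes "is_solution k (x, y, z)"
  shows "is_solution k (x, k * x * z - 2 * z - y, z)"
    "mu_hat2 (rat_triple (x, y, z)) = rat_triple (x, k * x * z - 2 * z - y, z)"
    "y * (k * x * z - 2 * z - y) = x\<^sup>2 + z\<^sup>2"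
proof -
  have pos: "x > 0" "y > 0" "z > 0" and eq: "x\<^sup>2 + y\<^sup>2 + z\<^sup>2 + 2 * y * z = k * x * y * z"
    using assms by (auto simp: is_solution_def)
  show prod: "y * (k * x * z - 2 * z - y) = x\<^sup>2 + z\<^sup>2"
    using eq by (simp add: algebra_simps power2_eq_square)
  note v = vieta_sum[OF pos(2) prod]
  have c: "x\<^sup>2 + z\<^sup>2 > 0"
    using pos by (simp add: add_pos_pos)
  define w where "w = k * x * z - 2 * z - y"
  have "x\<^sup>2 + w\<^sup>2 + z\<^sup>2 + 2 * w * z = k * x * w * z"
    using eq unfolding w_def by (simp add: algebra_simps power2_eq_square)
  then show "is_solution k (x, k * x * z - 2 * z - y, z)"
    using v(1)[OF c] pos by (simp add: is_solution_def w_def)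
  show "mu_hat2 (rat_triple (x, y, z)) = rat_triple (x, k * x * z - 2 * z - y, z)"
    using v(2)[OF c] pos by (simp add: mu_hat2_def rat_triple_def pos_rat3_def)
qed

lemma is_solution_swap: "is_solution k (x, y, z) \<longleftrightarrow> is_solution k (x, z, y)"
  by (auto simp: is_solution_def algebra_simps)

text \<open>Swapping the last two coordinates preserves the equation and turns
  \<open>mu_hat3\<close> into \<open>mu_hat2\<close>.\<close>

lemma vieta_mu_hat3:
  assumes "is_solution k (x, y, z)"
  shows "is_solution k (x, y, k * x * y - 2 * y - z)"
    "mu_hat3 (rat_triple (x, y, z)) = rat_triple (x, y, k * x * y - 2 * y - z)"
    "z * (k * x * y - 2 * y - z) = x\<^sup>2 + y\<^sup>2"
proof -
  have sol: "is_solution k (x, z, y)"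
    using assms by (simp add: is_solution_swap)
  show "is_solution k (x, y, k * x * y - 2 * y - z)"
    "z * (k * x * y - 2 * y - z) = x\<^sup>2 + y\<^sup>2"
    using vieta_mu_hat2(1,3)[OF sol] by (simp_all add: is_solution_swap)
  show "mu_hat3 (rat_triple (x, y, z)) = rat_triple (x, y, k * x * y - 2 * y - z)"
    using vieta_mu_hat2(2)[OF sol] is_solution_pos_rat3[OF sol] is_solution_pos_rat3[OF assms]
    by (simp add: mu_hat2_def mu_hat3_def rat_triple_def)
qed

text \<open>The generators divide, so orbit points are a priori only rational; the Vieta form of the
  generators keeps them integral. This is the source of the divisibility claims of the
  theorem.\<close>

lemma Gamma_hat_orbit_solution:
  assumes "is_solution k s" "q \<in> Gamma_hat_orbit (rat_triple s)"
  obtains t where "q = rat_triple t" "is_solution k t"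
proof -
  have "\<exists>t. q = rat_triple t \<and> is_solution k t"
    using assms(2) is_solution_pos_rat3[OF assms(1)]
  proof (induction rule: Gamma_hat_orbit_induct)
    case base
    then show ?case using assms(1) by blast
  next
    case (mu1 r)
    then show ?case by (metis prod_cases3 vieta_mu_hat1(1,2))
  next
    case (mu2 r)
    then show ?case by (metis prod_cases3 vieta_mu_hat2(1,2))
  next
    case (mu3 r)
    then show ?case by (metis prod_cases3 vieta_mu_hat3(1,2))
  qed
  then show thesis using that by blast
qed

section \<open>Passing between the equations by scaling\<close>

text \<open>The left side of the equation has degree two and the right side degree three, so one
  factor \<open>d\<close> survives and joins the coefficient.\<close>

lemma is_solution_scale:
  assumes "d > 0"
  shows "is_solution k (d * x, d * y, d * z) \<longleftrightarrow> is_solution (k * d) (x, y, z)"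
proof -
  have "(d * x)\<^sup>2 + (d * y)\<^sup>2 + (d * z)\<^sup>2 + 2 * (d * y) * (d * z) = d\<^sup>2 * (x\<^sup>2 + y\<^sup>2 + z\<^sup>2 + 2 * y * z)"
    "k * (d * x) * (d * y) * (d * z) = d\<^sup>2 * (k * d * x * y * z)"
    by (simp_all add: algebra_simps power2_eq_square)
  moreover have "d\<^sup>2 * a = d\<^sup>2 * b \<longleftrightarrow> a = b" for a b
    using assms by simp
  ultimately have "(d * x)\<^sup>2 + (d * y)\<^sup>2 + (d * z)\<^sup>2 + 2 * (d * y) * (d * z) = k * (d * x) * (d * y) * (d * z)
      \<longleftrightarrow> x\<^sup>2 + y\<^sup>2 + z\<^sup>2 + 2 * y * z = k * d * x * y * z"
    by metis
  then show ?thesis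
    using assms by (simp add: is_solution_def zero_less_mult_iff)
qed

lemma rat_triple_scale: "rat_triple (d * x, d * y, d * z) = scale3 (of_int d) (rat_triple (x, y, z))"
  by (simp add: rat_triple_def scale3_def)

lemma solution_in_scaled_orbit_iff:
  assumes "d > 0" and s: "is_solution (k * d) s"
  shows "is_solution k (x, y, z) \<and> rat_triple (x, y, z) \<in> Gamma_hat_orbit (scale3 (of_int d) (rat_triple s))
    \<longleftrightarrow> d dvd x \<and> d dvd y \<and> d dvd z \<and> is_solution (k * d) (x div d, y div d, z div d)
      \<and> rat_triple (x div d, y div d, z div d) \<in> Gamma_hat_orbit (rat_triple s)"
    (is "?L \<longleftrightarrow> ?R")
proof -
  have d: "(of_int d :: rat) > 0" using assms(1) by simp
  note orbit_iff = Gamma_hat_orbit_scale3_iff[OF d is_solution_pos_rat3[OF s]]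
  show ?thesis
  proof
    assume L: ?L
    \<comment> \<open>Dividing by \<open>d\<close> gives a rational point in the orbit of
      \<open>s\<close>. As \<open>s\<close> is an integral solution, that point is integral, which
      means that \<open>d\<close> divides all three coordinates.\<close>
    have "rat_triple (x, y, z) = scale3 (of_int d) (scale3 (1 / of_int d) (rat_triple (x, y, z)))"
      using d by (simp add: rat_triple_def scale3_def)
    with L obtain t where t: "scale3 (1 / of_int d) (rat_triple (x, y, z)) = rat_triple t"
      by (metis orbit_iff Gamma_hat_orbit_solution[OF s])
    obtain u v w where "t = (u, v, w)" by (cases t)
    with t have "(of_int x :: rat) = of_int (d * u)" "(of_int y :: rat) = of_int (d * v)"
      "(of_int z :: rat) = of_int (d * w)"
      using d by (auto simp: rat_triple_def scale3_def field_simps)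
    then have "x = d * u" "y = d * v" "z = d * w"
      by (simp_all only: of_int_eq_iff)
    with L assms(1) show ?R
      by (simp add: is_solution_scale rat_triple_scale orbit_iff)
  next
    assume R: ?R
    then obtain u v w where "x = d * u" "y = d * v" "z = d * w"
      by (meson dvdE)
    with R assms(1) show ?L
      by (simp add: is_solution_scale rat_triple_scale orbit_iff)
  qed
qed

section \<open>Descent to reduced solutions\<close>

lemma vieta_decrease:
  fixes x :: int
  assumes "x > 0" "x * x' = c" "c < x\<^sup>2"
  shows "x' < x"
  using assms by (auto simp: power2_eq_square)

text \<open>Each of the three inequalities in \<open>reduced\<close> compares the square of a
  coordinate with the product of the two roots, so it says that the corresponding generator does not
  decrease that coordinate. If one fails, the generator lowers \<open>x + y + z\<close>, and
  applying it again leads back to the given solution.\<close>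

lemma in_orbit_if_unique_reduced:
  assumes s: "is_solution k s"
    and reduced: "\<And>x y z. is_solution k (x, y, z) \<Longrightarrow> x \<le> y + z \<Longrightarrow> y\<^sup>2 \<le> x\<^sup>2 + z\<^sup>2 \<Longrightarrow> z\<^sup>2 \<le> x\<^sup>2 + y\<^sup>2
      \<Longrightarrow> (x, y, z) = s"
    and "is_solution k (x, y, z)"
  shows "rat_triple (x, y, z) \<in> Gamma_hat_orbit (rat_triple s)"
  using assms(3)
proof (induction "nat (x + y + z)" arbitrary: x y z rule: less_induct)
  case less
  have pos: "x > 0" "y > 0" "z > 0"
    using less.prems by (auto simp: is_solution_def)
  note r = is_solution_pos_rat3[OF less.prems]
  note step = Gamma_hat_orbit_step[OF is_solution_pos_rat3[OF s]]
  consider "x > y + z" | "y\<^sup>2 > x\<^sup>2 + z\<^sup>2" | "z\<^sup>2 > x\<^sup>2 + y\<^sup>2" | "(x, y, z) = s"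
    using reduced[OF less.prems] by linarith
  then show ?case
  proof cases
    case 1
    note v = vieta_mu_hat1[OF less.prems]
    have "(y + z)\<^sup>2 < x\<^sup>2"
      using 1 pos by (intro power_strict_mono) auto
    then have "k * y * z - x < x"
      by (rule vieta_decrease[OF pos(1) v(3)])
    then have "rat_triple (k * y * z - x, y, z) \<in> Gamma_hat_orbit (rat_triple s)"
      using pos by (intro less.hyps v(1)) simp
    with step(1) v(2) mu_hat_involution(1)[OF r] show ?thesis by metis
  next
    case 2
    note v = vieta_mu_hat2[OF less.prems]
    have "k * x * z - 2 * z - y < y"
      using 2 by (rule vieta_decrease[OF pos(2) v(3)])
    then have "rat_triple (x, k * x * z - 2 * z - y, z) \<in> Gamma_hat_orbit (rat_triple s)"
      using pos by (intro less.hyps v(1)) simp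
    with step(2) v(2) mu_hat_involution(2)[OF r] show ?thesis by metis
  next
    case 3
    note v = vieta_mu_hat3[OF less.prems]
    have "k * x * y - 2 * y - z < z"
      using 3 by (rule vieta_decrease[OF pos(3) v(3)])
    then have "rat_triple (x, y, k * x * y - 2 * y - z) \<in> Gamma_hat_orbit (rat_triple s)"
      using pos by (intro less.hyps v(1)) simp
    with step(3) v(2) mu_hat_involution(3)[OF r] show ?thesis by metis
  next
    case 4
    with r show ?thesis by (simp add: Gamma_hat_orbit_refl)
  qed
qed

section \<open>Bounds on reduced solutions\<close>

text \<open>
  Applied to the largest coordinate as the smaller root \<open>r\<close>, with \<open>t\<close> the second largest coordinate.
\<close>
lemma quadratic_nonneg_below_root:
  fixes r t b c :: int
  assumes "r > 0" "r * (b - r) = c" "r\<^sup>2 \<le> c" "t \<le> r"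
  shows "t\<^sup>2 - b * t + c \<ge> 0"
proof -
  have "r * r \<le> r * (b - r)"
    using assms by (simp add: power2_eq_square)
  then have "r \<le> b - r"
    using assms(1) by simp
  then have "(r - t) * ((b - r) - t) \<ge> 0"
    using assms(4) by simp
  also have "(r - t) * ((b - r) - t) = t\<^sup>2 - b * t + c"
    unfolding assms(2)[symmetric] by (simp add: algebra_simps power2_eq_square)
  finally show ?thesis .
qed

text \<open>The cases are the positions of \<open>x\<close> relative to \<open>z \<le> y\<close>.
  The largest coordinate is the smaller root of its quadratic, so the quadratic is nonnegative at
  the second largest coordinate. This bounds \<open>k\<close> times the smallest coordinate by 5.
  The finer inequality kept in the last two cases serves to bound the middle coordinate.\<close>

lemma reduced_solution_cases:
  assumes sol: "is_solution k (x, y, z)"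
    and red: "x \<le> y + z" "y\<^sup>2 \<le> x\<^sup>2 + z\<^sup>2" and "z \<le> y"
  obtains "x \<le> z" "k * x \<le> 5"
  | "z \<le> x" "x \<le> y" "k * x\<^sup>2 * z \<le> 2 * x\<^sup>2 + 2 * x * z + z\<^sup>2" "k * z \<le> 5"
  | "y \<le> x" "k * y\<^sup>2 * z \<le> y\<^sup>2 + (y + z)\<^sup>2" "k * z \<le> 5"
proof -
  have pos: "x > 0" "y > 0" "z > 0"
    using sol by (auto simp: is_solution_def)
  have f: "t\<^sup>2 - (k * x * z - 2 * z) * t + (x\<^sup>2 + z\<^sup>2) \<ge> 0" if "t \<le> y" for t
    using vieta_mu_hat2(3)[OF sol] red(2) pos that
    by (intro quadratic_nonneg_below_root) auto
  have "x\<^sup>2 \<le> (y + z)\<^sup>2"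
    using red(1) pos by (intro power_mono) auto
  then have g: "t\<^sup>2 - (k * y * z) * t + (y + z)\<^sup>2 \<ge> 0" if "t \<le> x" for t
    using vieta_mu_hat1(3)[OF sol] pos that
    by (intro quadratic_nonneg_below_root) auto
  \<comment> \<open>Shared by the last two cases: \<open>a\<close> becomes the middle coordinate,
    \<open>b\<close> and \<open>e\<close> both the smallest. The 5 arises as 2 + 2 + 1 after
    replacing \<open>e\<close> by \<open>a\<close>.\<close>
  have le5: "k * b \<le> 5" if "a > 0" "0 \<le> e" "e \<le> a" "k * a\<^sup>2 * b \<le> 2 * a\<^sup>2 + 2 * a * e + e\<^sup>2" for a b e
  proof -
    have "a * e \<le> a * a" "e * e \<le> a * a"
      using that by (auto intro: mult_mono)
    then have "(k * b) * a\<^sup>2 \<le> 5 * a\<^sup>2"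
      using that(4) by (simp add: algebra_simps power2_eq_square)
    then show ?thesis using that(1) by simp
  qed
  consider "x \<le> z" | "z \<le> x" "x \<le> y" | "y \<le> x" using \<open>z \<le> y\<close> by linarith
  then show thesis
  proof cases
    case 1
    have "k * z\<^sup>2 * x \<le> 4 * z\<^sup>2 + x\<^sup>2"
      using f[OF \<open>z \<le> y\<close>] by (simp add: algebra_simps power2_eq_square)
    moreover have "x\<^sup>2 \<le> z\<^sup>2"
      using 1 pos by (intro power_mono) auto
    ultimately have "(k * x) * z\<^sup>2 \<le> 5 * z\<^sup>2"
      by (simp add: algebra_simps)
    then show ?thesis using that(1) 1 pos by simp
  next
    case 2
    have "k * x\<^sup>2 * z \<le> 2 * x\<^sup>2 + 2 * x * z + z\<^sup>2"
      using f[OF 2(2)] by (simp add: algebra_simps power2_eq_square)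
    then show ?thesis using that(2) 2 le5[of x z z] pos by simp
  next
    case 3
    have *: "k * y\<^sup>2 * z \<le> y\<^sup>2 + (y + z)\<^sup>2"
      using g[OF 3] by (simp add: algebra_simps power2_eq_square)
    then have "k * y\<^sup>2 * z \<le> 2 * y\<^sup>2 + 2 * y * z + z\<^sup>2"
      by (simp add: algebra_simps power2_eq_square)
    then show ?thesis using that(3) 3 * le5[of y z z] pos \<open>z \<le> y\<close> by simp
  qed
qed

section \<open>Classification of the reduced solutions for \<open>k = 2\<close> and
  \<open>k = 5\<close>\<close>

text \<open>The smallest coordinate is 1 or 2. Completing squares turns every unwanted configuration
  into a square, or a sum of squares, plus a positive quantity equal to zero; only
  \<open>z = y = 2\<close> with \<open>y \<le> x\<close> survives, where the equation becomes (x -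
  4)^2 = 0.\<close>

lemma reduced_solution_E2_aux:
  assumes sol: "is_solution 2 (x, y, z)"
    and red: "x \<le> y + z" "y\<^sup>2 \<le> x\<^sup>2 + z\<^sup>2" and "z \<le> y"
  shows "(x, y, z) = (4, 2, 2)"
proof -
  have pos: "x > 0" "y > 0" "z > 0" and eq: "x\<^sup>2 + (y + z)\<^sup>2 = 2 * x * y * z"
    using sol by (auto simp: is_solution_def algebra_simps power2_eq_square)
  have z: "z = 2" if "2 * z \<le> 5"
  proof -
    have "z \<noteq> 1"
    proof
      assume "z = 1"
      then have "(x - y)\<^sup>2 + 2 * y + 1 = 0"
        using eq by (simp add: algebra_simps power2_eq_square)
      with pos show False by (smt (verit) zero_le_power2)
    qed
    with that pos show ?thesis by linarith
  qed
  show ?thesis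
  proof (cases rule: reduced_solution_cases[OF sol red \<open>z \<le> y\<close>])
    case 1
    then have "x = 1 \<or> x = 2" using pos by linarith
    \<comment> \<open>The first disjunct is the equation for \<open>x = 2\<close>, the second the
      one for \<open>x = 1\<close>.\<close>
    then have "(y - z)\<^sup>2 + 4 = 0 \<or> 1 + y\<^sup>2 + z\<^sup>2 = 0"
      using eq by (auto simp: algebra_simps power2_eq_square)
    then show ?thesis by (smt (verit) zero_le_power2)
  next
    case 2
    note z2 = z[OF 2(4)]
    have "2 * x\<^sup>2 \<le> 4 * x + 4"
      using 2(3) z2 by (simp add: algebra_simps)
    then have "x * (x - 2) \<le> 2" by (simp add: algebra_simps power2_eq_square)
    moreover have "x * (x - 2) \<ge> 3 * 1" if "x \<ge> 3" using that by (intro mult_mono) auto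
    ultimately have "x = 2" using 2(1) z2 by linarith
    with eq z2 have "(y - 2)\<^sup>2 + 4 = 0" by (simp add: algebra_simps power2_eq_square)
    then show ?thesis by (smt (verit) zero_le_power2)
  next
    case 3
    note z2 = z[OF 3(3)]
    have "y * (y - 2) \<le> 2"
      using 3(2) z2 by (simp add: algebra_simps power2_eq_square)
    moreover have "y * (y - 2) \<ge> 3 * 1" if "y \<ge> 3" using that by (intro mult_mono) auto
    ultimately have y2: "y = 2" using \<open>z \<le> y\<close> z2 by linarith
    with eq z2 have "(x - 4)\<^sup>2 = 0" by (simp add: algebra_simps power2_eq_square)
    with y2 z2 show ?thesis by simp
  qed
qed

text \<open>The equation and the conditions are symmetric in \<open>y\<close> and \<open>z\<close>,
  so one may assume \<open>z \<le> y\<close>.\<close>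

lemma reduced_solution_E2:
  assumes "is_solution 2 (x, y, z)" "x \<le> y + z" "y\<^sup>2 \<le> x\<^sup>2 + z\<^sup>2" "z\<^sup>2 \<le> x\<^sup>2 + y\<^sup>2"
  shows "(x, y, z) = (4, 2, 2)"
proof (cases "z \<le> y")
  case True
  with assms show ?thesis by (intro reduced_solution_E2_aux)
next
  case False
  with assms have "(x, z, y) = (4, 2, 2)"
    by (intro reduced_solution_E2_aux) (simp_all add: is_solution_swap add.commute)
  then show ?thesis by simp
qed

text \<open>The bound 5 forces the smallest coordinate to be 1. Each ordering then leads to
  \<open>x = z = 1\<close>, after which \<open>y\<^sup>2 \<le> 2\<close> leaves only
  \<open>y = 1\<close>.\<close>

lemma reduced_solution_E5_aux:
  assumes sol: "is_solution 5 (x, y, z)"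
    and red: "x \<le> y + z" "y\<^sup>2 \<le> x\<^sup>2 + z\<^sup>2" and "z \<le> y"
  shows "(x, y, z) = (1, 1, 1)"
proof -
  have pos: "x > 0" "y > 0" "z > 0" and eq: "x\<^sup>2 + (y + z)\<^sup>2 = 5 * x * y * z"
    using sol by (auto simp: is_solution_def algebra_simps power2_eq_square)
  have xz: ?thesis if "x = 1" "z = 1"
  proof -
    have "y = 1"
    proof (rule ccontr)
      assume "y \<noteq> 1"
      then have "2\<^sup>2 \<le> y\<^sup>2" using pos by (intro power_mono) auto
      then show False using red(2) that by simp
    qed
    with that show ?thesis by simp
  qed
  have one: "a = 1" if "a > 0" "3 * a\<^sup>2 \<le> 2 * a + 1" for a :: int
  proof (rule ccontr)
    assume "a \<noteq> 1"
    then have "2 * a \<le> a * a" using that(1) by (intro mult_right_mono) auto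
    then have "4 * a \<le> 1" using that(2) by (simp add: power2_eq_square)
    then show False using that(1) by linarith
  qed
  show ?thesis
  proof (cases rule: reduced_solution_cases[OF sol red \<open>z \<le> y\<close>])
    case 1
    then have x: "x = 1" using pos by linarith
    have "y\<^sup>2 \<le> 1 + z\<^sup>2" using red(2) x by simp
    \<comment> \<open>If \<open>y\<close> exceeded \<open>z\<close>, its square would be at least
      z^2 + 2 z + 1, which is more than z^2 + 1.\<close>
    have "y = z"
    proof (rule ccontr)
      assume "y \<noteq> z"
      then have "(z + 1)\<^sup>2 \<le> y\<^sup>2" using \<open>z \<le> y\<close> pos by (intro power_mono) auto
      with \<open>y\<^sup>2 \<le> 1 + z\<^sup>2\<close> pos show False by (simp add: power2_eq_square algebra_simps)
    qed
    with eq x have "z\<^sup>2 = 1" by (simp add: algebra_simps power2_eq_square)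
    with pos have "z = 1" by (simp add: power2_eq_1_iff)
    with x xz show ?thesis by blast
  next
    case 2
    then have z: "z = 1" using pos by linarith
    have "x = 1" using 2(3) z pos by (intro one) (simp_all add: algebra_simps)
    with z xz show ?thesis by blast
  next
    case 3
    then have z: "z = 1" using pos by linarith
    have y: "y = 1" using 3(2) z pos by (intro one) (simp_all add: algebra_simps power2_eq_square)
    \<comment> \<open>The other root 4 belongs to the image (4, 1, 1) of (1, 1, 1) under
      \<open>mu_hat1\<close>; the condition \<open>x \<le> y + z\<close> rules it out.\<close>
    have "(x - 1) * (x - 4) = 0"
      using eq z y by (simp add: algebra_simps power2_eq_square)
    moreover have "x \<le> 2" using red(1) y z by simp
    ultimately have "x = 1" by simp
    with z xz show ?thesis by blast
  qed
qed

lemma reduced_solution_E5: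
  assumes "is_solution 5 (x, y, z)" "x \<le> y + z" "y\<^sup>2 \<le> x\<^sup>2 + z\<^sup>2" "z\<^sup>2 \<le> x\<^sup>2 + y\<^sup>2"
  shows "(x, y, z) = (1, 1, 1)"
proof (cases "z \<le> y")
  case True
  with assms show ?thesis by (intro reduced_solution_E5_aux)
next
  case False
  with assms have "(x, z, y) = (1, 1, 1)"
    by (intro reduced_solution_E5_aux) (simp_all add: is_solution_swap add.commute)
  then show ?thesis by simp
qed

section \<open>Single orbits and the final equivalences\<close>

lemma E2_single_orbit:
  assumes "is_solution 2 (x, y, z)"
  shows "rat_triple (x, y, z) \<in> Gamma_hat_orbit (4, 2, 2)"
proof -
  have "is_solution 2 (4, 2, 2)" by (simp add: is_solution_def)
  then have "rat_triple (x, y, z) \<in> Gamma_hat_orbit (rat_triple (4, 2, 2))"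
    using reduced_solution_E2 assms by (rule in_orbit_if_unique_reduced)
  then show ?thesis by (simp add: rat_triple_def)
qed

lemma E4_single_orbit:
  assumes "is_solution 4 (x, y, z)"
  shows "rat_triple (x, y, z) \<in> Gamma_hat_orbit (2, 1, 1)"
proof -
  have "is_solution 2 (2 * x, 2 * y, 2 * z)"
    using assms is_solution_scale[of 2 2 x y z] by simp
  from E2_single_orbit[OF this]
  have "scale3 2 (rat_triple (x, y, z)) \<in> Gamma_hat_orbit (scale3 2 (2, 1, 1))"
    using rat_triple_scale[of 2 x y z] by (simp add: scale3_def)
  then show ?thesis
    by (subst (asm) Gamma_hat_orbit_scale3_iff) (simp_all add: pos_rat3_def)
qed

lemma E5_single_orbit:
  assumes "is_solution 5 (x, y, z)"
  shows "rat_triple (x, y, z) \<in> Gamma_hat_orbit (1, 1, 1)"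
proof -
  have "is_solution 5 (1, 1, 1)" by (simp add: is_solution_def)
  then have "rat_triple (x, y, z) \<in> Gamma_hat_orbit (rat_triple (1, 1, 1))"
    using reduced_solution_E5 assms by (rule in_orbit_if_unique_reduced)
  then show ?thesis by (simp add: rat_triple_def)
qed

theorem proposition4p7:
  fixes A1 A2 A3 :: int
  assumes "A1 > 0" and "A2 > 0" and "A3 > 0"
  shows
    "((is_solution 1 (A1, A2, A3) \<and> rat_triple (A1, A2, A3) \<in> Gamma_hat_orbit (9, 6, 3))
      \<longleftrightarrow> (3 dvd A1 \<and> 3 dvd A2 \<and> 3 dvd A3
           \<and> is_solution 3 (A1 div 3, A2 div 3, A3 div 3)
           \<and> rat_triple (A1 div 3, A2 div 3, A3 div 3) \<in> Gamma_hat_orbit (3, 2, 1)))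
     \<and>
     ((is_solution 1 (A1, A2, A3) \<and> rat_triple (A1, A2, A3) \<in> Gamma_hat_orbit (9, 3, 6))
      \<longleftrightarrow> (3 dvd A1 \<and> 3 dvd A2 \<and> 3 dvd A3
           \<and> is_solution 3 (A1 div 3, A2 div 3, A3 div 3)
           \<and> rat_triple (A1 div 3, A2 div 3, A3 div 3) \<in> Gamma_hat_orbit (3, 1, 2)))
     \<and>
     ((is_solution 1 (A1, A2, A3) \<and> rat_triple (A1, A2, A3) \<in> Gamma_hat_orbit (8, 4, 4))
      \<longleftrightarrow> (2 dvd A1 \<and> 2 dvd A2 \<and> 2 dvd A3
           \<and> is_solution 2 (A1 div 2, A2 div 2, A3 div 2)))
     \<and>
     ((2 dvd A1 \<and> 2 dvd A2 \<and> 2 dvd A3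
       \<and> is_solution 2 (A1 div 2, A2 div 2, A3 div 2))
      \<longleftrightarrow> (4 dvd A1 \<and> 4 dvd A2 \<and> 4 dvd A3
           \<and> is_solution 4 (A1 div 4, A2 div 4, A3 div 4)))
     \<and>
     ((is_solution 1 (A1, A2, A3) \<and> rat_triple (A1, A2, A3) \<in> Gamma_hat_orbit (5, 5, 5))
      \<longleftrightarrow> (5 dvd A1 \<and> 5 dvd A2 \<and> 5 dvd A3
           \<and> is_solution 5 (A1 div 5, A2 div 5, A3 div 5)))"
proof -
  \<comment> \<open>The factor 1 is kept so that these facts match the coefficient
    \<open>k * d\<close> at \<open>k = 1\<close>.\<close>
  have s: "is_solution (1 * 3) (3, 2, 1)" "is_solution (1 * 3) (3, 1, 2)"
    "is_solution (1 * 2) (4, 2, 2)" "is_solution (1 * 4) (2, 1, 1)" "is_solution (1 * 5) (1, 1, 1)"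
    by (simp_all add: is_solution_def)
  note iff = solution_in_scaled_orbit_iff[where k = 1 and x = A1 and y = A2 and z = A3]
  have part1: "is_solution 1 (A1, A2, A3) \<and> rat_triple (A1, A2, A3) \<in> Gamma_hat_orbit (9, 6, 3)
      \<longleftrightarrow> 3 dvd A1 \<and> 3 dvd A2 \<and> 3 dvd A3 \<and> is_solution 3 (A1 div 3, A2 div 3, A3 div 3)
        \<and> rat_triple (A1 div 3, A2 div 3, A3 div 3) \<in> Gamma_hat_orbit (3, 2, 1)"
    using iff[OF _ s(1)] by (simp add: scale3_def rat_triple_def)
  have part1': "is_solution 1 (A1, A2, A3) \<and> rat_triple (A1, A2, A3) \<in> Gamma_hat_orbit (9, 3, 6)
      \<longleftrightarrow> 3 dvd A1 \<and> 3 dvd A2 \<and> 3 dvd A3 \<and> is_solution 3 (A1 div 3, A2 div 3, A3 div 3)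
        \<and> rat_triple (A1 div 3, A2 div 3, A3 div 3) \<in> Gamma_hat_orbit (3, 1, 2)"
    using iff[OF _ s(2)] by (simp add: scale3_def rat_triple_def)
  \<comment> \<open>All solutions of the scaled equation lie in one orbit, so the orbit condition on
    the right disappears.\<close>
  have part2: "is_solution 1 (A1, A2, A3) \<and> rat_triple (A1, A2, A3) \<in> Gamma_hat_orbit (8, 4, 4)
      \<longleftrightarrow> 2 dvd A1 \<and> 2 dvd A2 \<and> 2 dvd A3 \<and> is_solution 2 (A1 div 2, A2 div 2, A3 div 2)"
    using iff[OF _ s(3)] E2_single_orbit[of "A1 div 2" "A2 div 2" "A3 div 2"]
    by (auto simp: scale3_def rat_triple_def)
  \<comment> \<open>Since (8, 4, 4) is both 2 (4, 2, 2) and 4 (2, 1, 1), its orbit links the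
    conditions for \<open>k = 2\<close> and \<open>k = 4\<close>.\<close>
  have part2': "is_solution 1 (A1, A2, A3) \<and> rat_triple (A1, A2, A3) \<in> Gamma_hat_orbit (8, 4, 4)
      \<longleftrightarrow> 4 dvd A1 \<and> 4 dvd A2 \<and> 4 dvd A3 \<and> is_solution 4 (A1 div 4, A2 div 4, A3 div 4)"
    using iff[OF _ s(4)] E4_single_orbit[of "A1 div 4" "A2 div 4" "A3 div 4"]
    by (auto simp: scale3_def rat_triple_def)
  have part3: "is_solution 1 (A1, A2, A3) \<and> rat_triple (A1, A2, A3) \<in> Gamma_hat_orbit (5, 5, 5)
      \<longleftrightarrow> 5 dvd A1 \<and> 5 dvd A2 \<and> 5 dvd A3 \<and> is_solution 5 (A1 div 5, A2 div 5, A3 div 5)"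
    using iff[OF _ s(5)] E5_single_orbit[of "A1 div 5" "A2 div 5" "A3 div 5"]
    by (auto simp: scale3_def rat_triple_def)
  from part1 part1' part2 part2' part3 show ?thesis by (simp only: refl simp_thms)
qed

end
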